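(* $$\tilde{\mathfrak{S}}(312,321)^{\mathsf{des},\mathsf{iar},\mathsf{comp}}(t,r,p)=\frac{1}{1-rpz}+\frac{(1-z)tz}{(1-rpz)(1-rz)(1-(1+p)z+(1-t)pz^2)}.$$
   Context: $\mathfrak{S}_n$ is the set of permutations $\pi=\pi(1)\cdots\pi(n)$ of $[n]=\{1,\dots,n\}$. A permutation $\pi\in\mathfrak{S}_n$ contains the pattern $\sigma\in\mathfrak{S}_k$ if there are $j_1<\cdots<j_k$ such that $\pi(j_a)<\pi(j_b)$ if and only if $\sigma(a)<\sigma(b)$ for all $1\le a<b\le k$; otherwise it avoids $\sigma$. For a set $P$ of patterns, $\mathfrak{S}_n(P)$ is the set of $\pi\in\mathfrak{S}_n$ avoiding every pattern in $P$. For $\pi\in\mathfrak{S}_n$: $\mathrm{DES}(\pi)=\{i\in[n-1]:\pi(i)>\pi(i+1)\}$, $\mathsf{des}(\pi)=|\mathrm{DES}(\pi)|$, $\mathsf{iar}(\pi)=\min(\mathrm{DES}(\pi)\cup\{n\})$, $\mathsf{comp}(\pi)=|\{i\in[n]:\pi(j)\le i\text{ for all }j\le i\}|$. Define the formal power series in $z$ $$\mathfrak{S}(P)^{\mathsf{des},\mathsf{iar},\mathsf{comp}}(t,r,p;z)=\sum_{n\ge0}z^n\sum_{\pi\in\mathfrak{S}_n(P)}t^{\mathsf{des}(\pi)}r^{\mathsf{iar}(\pi)}p^{\mathsf{comp}(\pi)},$$ where the empty permutation ($n=0$) contributes $1$, and $\tilde{\mathfrak{S}}(P)^{\mathsf{des},\mathsf{iar},\mathsf{comp}}(t,r,p)=\big(\mathfrak{S}(P)^{\mathsf{des},\mathsf{iar},\mathsf{comp}}(t,r,p;z)-1\big)/(rpz)$.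 *)

theory Defs
  imports
    "HOL-Computational_Algebra.Computational_Algebra"
    "HOL-Combinatorics.Multiset_Permutations"
begin

text \<open>
  A permutation of \<open>{1..n}\<close> is the list \<open>[\<pi>(1), \<dots>, \<pi>(n)]\<close> of its one-line notation.  Positions
  are counted from 1, as in the usual definitions of the statistics.
\<close>

definition letter :: "nat list \<Rightarrow> nat \<Rightarrow> nat" where
  "letter \<pi> i = \<pi> ! (i - 1)"

definition contains_pattern :: "nat list \<Rightarrow> nat list \<Rightarrow> bool" where
  "contains_pattern \<pi> \<sigma> \<longleftrightarrow>
     (\<exists>j :: nat \<Rightarrow> nat.
        strict_mono_on {1..length \<sigma>} j \<and>
        j ` {1..length \<sigma>} \<subseteq> {1..length \<pi>} \<and>
        (\<forall>a b. 1 \<le> a \<and> a < b \<and> b \<le> length \<sigma> \<longrightarrow>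
           (letter \<pi> (j a) < letter \<pi> (j b) \<longleftrightarrow> letter \<sigma> a < letter \<sigma> b)))"

definition avoiders :: "nat list set \<Rightarrow> nat \<Rightarrow> nat list set" where
  "avoiders P n = {\<pi> \<in> permutations_of_set {1..n}. \<forall>\<sigma>\<in>P. \<not> contains_pattern \<pi> \<sigma>}"

definition DES :: "nat list \<Rightarrow> nat set" where
  "DES \<pi> = {i \<in> {1..<length \<pi>}. letter \<pi> i > letter \<pi> (i + 1)}"

definition des :: "nat list \<Rightarrow> nat" where
  "des \<pi> = card (DES \<pi>)"

definition iar :: "nat list \<Rightarrow> nat" where
  "iar \<pi> = Min (DES \<pi> \<union> {length \<pi>})"

definition comp :: "nat list \<Rightarrow> nat" where
  "comp \<pi> = card {i \<in> {1..length \<pi>}. \<forall>j\<in>{1..i}. letter \<pi> j \<le> i}"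

text \<open>The series in \<open>z\<close>; the coefficients of \<open>fps\<close> are indexed by the exponent of \<open>z\<close>.\<close>

definition gf :: "nat list set \<Rightarrow> 'a \<Rightarrow> 'a \<Rightarrow> 'a \<Rightarrow> 'a :: comm_semiring_1 fps" where
  "gf P t r p = Abs_fps (\<lambda>n. \<Sum>\<pi>\<in>avoiders P n. t ^ des \<pi> * r ^ iar \<pi> * p ^ comp \<pi>)"

text \<open>
  Quotients of power series are formed in the field of fractions of \<open>'a[[z]]\<close>, so that \<open>/\<close> is division
  in a field.
\<close>

definition const :: "'a :: idom \<Rightarrow> 'a fps fract" where
  "const c = to_fract (fps_const c)"

definition var_z :: "'a :: idom fps fract" where
  "var_z = to_fract fps_X"

definition gf_tilde :: "nat list set \<Rightarrow> 'a \<Rightarrow> 'a \<Rightarrow> 'a \<Rightarrow> 'a :: idom fps fract" where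
  "gf_tilde P t r p = (to_fract (gf P t r p) - 1) / (const r * const p * var_z)"

text \<open>The indeterminates \<open>t\<close>, \<open>r\<close>, \<open>p\<close>, with \<open>int poly poly poly\<close> read as \<open>\<int>[t][r][p]\<close>.\<close>

definition ind_t :: "int poly poly poly" where
  "ind_t = [:[:[:0, 1:]:]:]"

definition ind_r :: "int poly poly poly" where
  "ind_r = [:[:0, 1:]:]"

definition ind_p :: "int poly poly poly" where
  "ind_p = [:0, 1:]"

end

theory Submission
  imports Defs
begin

text \<open>
  Avoiding both 312 and 321 means that no letter has two smaller letters to its right.  The first
  letter of such a permutation is therefore 1 or 2, and once it is deleted and the other letters
  are standardised, an arbitrary avoider of length one less remains: a leading 1 or 2 is never the
  large letter of a forbidden pattern.  So each avoider \<open>\<pi>\<close> of positive length is \<open>prepend x \<sigma>\<close> for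
  exactly one \<open>x\<close> in \<open>{1, 2}\<close> and one avoider \<open>\<sigma>\<close> (with \<open>\<sigma>\<close> nonempty if \<open>x = 2\<close>).

  The statistics follow this step.  Prepending 1 adds a new component and lengthens the initial
  ascending run: the weight is multiplied by \<open>r p\<close>.  Prepending 2 enlarges the first component.  If
  \<open>\<sigma>\<close> starts with 2, only the initial run grows, giving a factor \<open>r\<close>; if \<open>\<sigma>\<close> starts with 1, a
  descent appears at position 1 and the initial run of \<open>\<sigma>\<close> is forgotten, so the new weight is
  \<open>t r\<close> times the weight of \<open>\<sigma>\<close> at \<open>r = 1\<close>.  If \<open>F r\<close> is the series of all avoiders and \<open>C r\<close> that
  of the avoiders starting with 2, this says
  \<open>F r = 1 + r p z F r + C r\<close> and \<open>C r = z (t r p z F 1 + r C r)\<close>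
  (lemmas \<open>gf_eq\<close> and \<open>gf_from_2_eq\<close>).  At \<open>r = 1\<close> the two equations determine \<open>F 1\<close>, namely
  \<open>(1 - (1 + p) z + (1 - t) p z\<^sup>2) F 1 = 1 - z\<close>, and then the general case determines \<open>F r\<close>.
  All of this happens in the ring of power series; division only enters at the end.
\<close>

section \<open>Avoidance\<close>

definition two_smaller_later :: "nat list \<Rightarrow> bool" where
  "two_smaller_later xs \<longleftrightarrow>
     (\<exists>i j k. i < j \<and> j < k \<and> k < length xs \<and> xs ! j < xs ! i \<and> xs ! k < xs ! i)"

lemma contains_pattern_3_iff:
  "contains_pattern \<pi> [a, b, c] \<longleftrightarrow>
     (\<exists>i j k. i < j \<and> j < k \<and> k < length \<pi> \<and>
        (\<pi> ! i < \<pi> ! j \<longleftrightarrow> a < b) \<and> (\<pi> ! i < \<pi> ! k \<longleftrightarrow> a < c) \<and> (\<pi> ! j < \<pi> ! k \<longleftrightarrow> b < c))"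
    (is "?L \<longleftrightarrow> ?R")
proof
  have I: "{1..length [a, b, c]} = {1, 2, 3}" by auto
  assume ?L
  then obtain f where f: "strict_mono_on {1, 2, 3} f" "f ` {1, 2, 3} \<subseteq> {1..length \<pi>}"
    and *: "\<And>x y. 1 \<le> x \<and> x < y \<and> y \<le> length [a, b, c] \<Longrightarrow>
      letter \<pi> (f x) < letter \<pi> (f y) \<longleftrightarrow> letter [a, b, c] x < letter [a, b, c] y"
    unfolding contains_pattern_def I by blast
  have "f 1 < f 2" "f 2 < f 3"
    using f(1) by (auto simp: strict_mono_on_def)
  moreover have "1 \<le> f 1" "f 3 \<le> length \<pi>" using f(2) by auto
  moreover have "(\<pi> ! (f 1 - 1) < \<pi> ! (f 2 - 1) \<longleftrightarrow> a < b)"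
    "(\<pi> ! (f 1 - 1) < \<pi> ! (f 3 - 1) \<longleftrightarrow> a < c)" "(\<pi> ! (f 2 - 1) < \<pi> ! (f 3 - 1) \<longleftrightarrow> b < c)"
    using *[of 1 2] *[of 1 3] *[of 2 3] by (simp_all add: letter_def)
  moreover have "f 1 - 1 < f 2 - 1" "f 2 - 1 < f 3 - 1" "f 3 - 1 < length \<pi>"
    using calculation(1-4) by linarith+
  ultimately show ?R by blast
next
  have I: "{1..length [a, b, c]} = {1, 2, 3}" by auto
  assume ?R
  then obtain i j k where ijk: "i < j" "j < k" "k < length \<pi>"
    and *: "\<pi> ! i < \<pi> ! j \<longleftrightarrow> a < b" "\<pi> ! i < \<pi> ! k \<longleftrightarrow> a < c" "\<pi> ! j < \<pi> ! k \<longleftrightarrow> b < c"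
    by blast
  define f where "f = (\<lambda>x::nat. if x = 1 then Suc i else if x = 2 then Suc j else Suc k)"
  have "strict_mono_on {1, 2, 3} f" "f ` {1, 2, 3} \<subseteq> {1..length \<pi>}"
    using ijk by (auto simp: strict_mono_on_def f_def)
  moreover have "letter \<pi> (f x) < letter \<pi> (f y) \<longleftrightarrow> letter [a, b, c] x < letter [a, b, c] y"
    if "1 \<le> x \<and> x < y \<and> y \<le> length [a, b, c]" for x y
  proof -
    from that have "x = 1 \<and> y = 2 \<or> x = 1 \<and> y = 3 \<or> x = 2 \<and> y = 3" by auto
    thus ?thesis using * by (elim disjE) (simp_all add: f_def letter_def)
  qed
  ultimately show ?L unfolding contains_pattern_def I by blast
qed

text \<open>
  The patterns 312 and 321 differ only in the order of their last two letters, so together they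
  leave that order free.
\<close>
lemma avoids_312_321_iff:
  assumes "distinct \<pi>"
  shows "(\<forall>\<sigma>\<in>{[3,1,2], [3,2,1]}. \<not> contains_pattern \<pi> \<sigma>) \<longleftrightarrow> \<not> two_smaller_later \<pi>"
proof -
  (* A pattern occurrence speaks of "not smaller"; distinctness turns it into "greater". *)
  have no_tie: "\<not> \<pi> ! i < \<pi> ! j \<longleftrightarrow> \<pi> ! j < \<pi> ! i" if "i < j" "j < length \<pi>" for i j
  proof -
    have "\<pi> ! i \<noteq> \<pi> ! j" using that assms by (simp add: nth_eq_iff_index_eq)
    thus ?thesis by linarith
  qed
  have "(i < j \<and> j < k \<and> k < length \<pi> \<and> \<pi> ! j < \<pi> ! i \<and> \<pi> ! k < \<pi> ! i) \<longleftrightarrow>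
      (i < j \<and> j < k \<and> k < length \<pi> \<and> \<not> \<pi> ! i < \<pi> ! j \<and> \<not> \<pi> ! i < \<pi> ! k)" for i j k
    using no_tie[of i j] no_tie[of i k] by linarith
  hence two: "two_smaller_later \<pi> \<longleftrightarrow> (\<exists>i j k. i < j \<and> j < k \<and> k < length \<pi> \<and>
      \<not> \<pi> ! i < \<pi> ! j \<and> \<not> \<pi> ! i < \<pi> ! k)"
    unfolding two_smaller_later_def by (simp only:)
  have "contains_pattern \<pi> [3,1,2] \<or> contains_pattern \<pi> [3,2,1] \<longleftrightarrow> two_smaller_later \<pi>"
    unfolding contains_pattern_3_iff two ex_disj_distrib[symmetric] by (intro ex_cong1) auto
  thus ?thesis by auto
qed

definition avoiding_perms :: "nat \<Rightarrow> nat list set" where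
  "avoiding_perms = avoiders {[3,1,2], [3,2,1]}"

lemma avoiding_perms_iff:
  "\<pi> \<in> avoiding_perms n \<longleftrightarrow> distinct \<pi> \<and> set \<pi> = {1..n} \<and> \<not> two_smaller_later \<pi>"
  unfolding avoiding_perms_def avoiders_def permutations_of_set_def using avoids_312_321_iff by auto

lemma two_smaller_later_Cons:
  "two_smaller_later (x # xs) \<longleftrightarrow>
     (\<exists>j k. j < k \<and> k < length xs \<and> xs ! j < x \<and> xs ! k < x) \<or> two_smaller_later xs"
  (is "?L \<longleftrightarrow> ?A \<or> _")
proof
  assume ?L
  then obtain i j k where *: "i < j" "j < k" "k < Suc (length xs)"
    "(x # xs) ! j < (x # xs) ! i" "(x # xs) ! k < (x # xs) ! i"
    by (auto simp: two_smaller_later_def)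
  then obtain j' k' where "j = Suc j'" "k = Suc k'"
    by (cases j; cases k) auto
  with * show "?A \<or> two_smaller_later xs"
    unfolding two_smaller_later_def by (cases i) auto
next
  assume "?A \<or> two_smaller_later xs"
  thus ?L
  proof
    assume ?A
    then obtain j k where "j < k" "k < length xs" "xs ! j < x" "xs ! k < x" by blast
    thus ?L unfolding two_smaller_later_def
      by (intro exI[of _ 0] exI[of _ "Suc j"] exI[of _ "Suc k"]) auto
  next
    assume "two_smaller_later xs"
    then obtain i j k where "i < j" "j < k" "k < length xs" "xs ! j < xs ! i" "xs ! k < xs ! i"
      unfolding two_smaller_later_def by blast
    thus ?L unfolding two_smaller_later_def
      by (intro exI[of _ "Suc i"] exI[of _ "Suc j"] exI[of _ "Suc k"]) auto
  qed
qed

lemma two_smaller_later_map: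
  assumes "strict_mono f"
  shows "two_smaller_later (map f xs) \<longleftrightarrow> two_smaller_later xs"
  unfolding two_smaller_later_def length_map
  by (intro ex_cong1) (auto simp: strict_mono_less[OF assms])

lemma two_smaller_later_Cons_distinct:
  assumes "distinct xs"
  shows "two_smaller_later (x # xs) \<longleftrightarrow>
     (\<exists>a\<in>set xs. \<exists>b\<in>set xs. a \<noteq> b \<and> a < x \<and> b < x) \<or> two_smaller_later xs"
proof -
  have "(\<exists>j k. j < k \<and> k < length xs \<and> xs ! j < x \<and> xs ! k < x) \<longleftrightarrow>
        (\<exists>a\<in>set xs. \<exists>b\<in>set xs. a \<noteq> b \<and> a < x \<and> b < x)" (is "?L \<longleftrightarrow> ?R")
  proof
    assume ?L thus ?R using assms
      by (metis less_trans nat_neq_iff nth_eq_iff_index_eq nth_mem)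
  next
    assume ?R thus ?L
      by (metis in_set_conv_nth nat_neq_iff)
  qed
  thus ?thesis by (simp add: two_smaller_later_Cons)
qed

section \<open>Prepending a letter\<close>

text \<open>
  The order-preserving relabelling of the letters that leaves out the value \<open>x\<close>; it undoes
  standardisation after the letter \<open>x\<close> has been removed.
\<close>
definition shift :: "nat \<Rightarrow> nat \<Rightarrow> nat" where
  "shift x v = (if v < x then v else Suc v)"

definition prepend :: "nat \<Rightarrow> nat list \<Rightarrow> nat list" where
  "prepend x \<sigma> = x # map (shift x) \<sigma>"

lemma strict_mono_shift: "strict_mono (shift x)"
  by (auto simp: strict_mono_def shift_def)

lemma inj_on_shift: "inj_on (shift x) A"
  by (auto simp: inj_on_def shift_def split: if_splits)

lemma shift_image:
  assumes "x \<in> {1..Suc n}"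
  shows "shift x ` {1..n} = {1..Suc n} - {x}"
proof (intro equalityI subsetI)
  fix v assume v: "v \<in> {1..Suc n} - {x}"
  show "v \<in> shift x ` {1..n}"
  proof (cases "v < x")
    case True
    thus ?thesis using assms v by (intro image_eqI[of _ _ v]) (auto simp: shift_def)
  next
    case False
    thus ?thesis using assms v by (intro image_eqI[of _ _ "v - 1"]) (auto simp: shift_def)
  qed
qed (use assms in \<open>auto simp: shift_def split: if_splits\<close>)

lemma inj_prepend: "inj (prepend x)"
  using inj_mapI[OF inj_on_shift[of x UNIV]]
  by (auto simp: prepend_def inj_def)

text \<open>
  At most one letter is below 2, so the new first letter cannot have two smaller letters after it.
\<close>
lemma prepend_avoiding:
  assumes "\<sigma> \<in> avoiding_perms n" "x \<in> {1, 2}" "x \<le> Suc n"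
  shows "prepend x \<sigma> \<in> avoiding_perms (Suc n)"
proof -
  have \<sigma>: "distinct \<sigma>" "set \<sigma> = {1..n}" "\<not> two_smaller_later \<sigma>"
    using assms(1) by (auto simp: avoiding_perms_iff)
  have x: "x \<in> {1..Suc n}" using assms by auto
  have s: "set (map (shift x) \<sigma>) = {1..Suc n} - {x}"
    using \<sigma> shift_image[OF x] by simp
  have d: "distinct (map (shift x) \<sigma>)"
    using \<sigma> by (simp add: distinct_map inj_on_shift)
  have "\<not> two_smaller_later (prepend x \<sigma>)"
    unfolding prepend_def two_smaller_later_Cons_distinct[OF d] s
      two_smaller_later_map[OF strict_mono_shift]
    using \<sigma> assms(2) by auto
  thus ?thesis
    using s d x by (auto simp: avoiding_perms_iff prepend_def)
qed

text \<open>
  A first letter \<open>x \<ge> 3\<close> is impossible, since the letters 1 and 2 would both follow it.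
\<close>
lemma avoiding_cases:
  assumes "\<pi> \<in> avoiding_perms (Suc n)"
  obtains x \<sigma> where "x \<in> {1, 2}" "x \<le> Suc n" "\<sigma> \<in> avoiding_perms n" "\<pi> = prepend x \<sigma>"
proof -
  have \<pi>: "distinct \<pi>" "set \<pi> = {1..Suc n}" "\<not> two_smaller_later \<pi>"
    using assms by (auto simp: avoiding_perms_iff)
  then obtain x xs where xs: "\<pi> = x # xs" by (cases \<pi>) auto
  have x: "x \<in> {1..Suc n}" using \<pi> xs by auto
  have s: "set xs = {1..Suc n} - {x}" and d: "distinct xs" using \<pi> xs by auto
  have "\<not> x \<ge> 3"
  proof
    assume "x \<ge> 3"
    hence "1 \<in> set xs" "2 \<in> set xs" "1 < x" "2 < x" using s x by auto
    hence "two_smaller_later \<pi>"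
      unfolding xs two_smaller_later_Cons_distinct[OF d] by (metis one_eq_numeral_iff semiring_norm(83))
    with \<pi> show False by simp
  qed
  hence x': "x \<in> {1, 2}" using x by auto
  have "xs \<in> permutations_of_set (shift x ` {1..n})"
    using s d shift_image[OF x] by (simp add: permutations_of_set_def)
  also have "\<dots> = map (shift x) ` permutations_of_set {1..n}"
    by (intro permutations_of_set_image_inj inj_on_shift)
  finally obtain \<sigma> where \<sigma>: "\<sigma> \<in> permutations_of_set {1..n}" "xs = map (shift x) \<sigma>" by auto
  have "\<not> two_smaller_later \<sigma>"
    using \<pi>(3) unfolding xs \<sigma>(2) two_smaller_later_Cons two_smaller_later_map[OF strict_mono_shift]
    by simp
  with \<sigma> have "\<sigma> \<in> avoiding_perms n" by (auto simp: avoiding_perms_iff permutations_of_set_def)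
  thus ?thesis using that[of x \<sigma>] x x' xs \<sigma>(2) by (auto simp: prepend_def)
qed

lemma avoiding_perms_0: "avoiding_perms 0 = {[]}"
  by (auto simp: avoiding_perms_iff two_smaller_later_def)

lemma finite_avoiding: "finite (avoiding_perms n)"
  by (simp add: avoiding_perms_def avoiders_def)

definition avoiding_from :: "nat \<Rightarrow> nat \<Rightarrow> nat list set" where
  "avoiding_from x n = {\<pi> \<in> avoiding_perms n. \<pi> \<noteq> [] \<and> hd \<pi> = x}"

lemma avoiding_from_0: "avoiding_from x 0 = {}"
  by (auto simp: avoiding_from_def avoiding_perms_0)

text \<open>
  The side condition \<open>x \<le> Suc n\<close> fails only for \<open>x = 2\<close> and \<open>n = 0\<close>: a permutation of length 1
  cannot start with 2.
\<close>
lemma avoiding_from_Suc: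
  assumes "x \<in> {1, 2}"
  shows "avoiding_from x (Suc n) = (if x \<le> Suc n then prepend x ` avoiding_perms n else {})"
proof -
  have "\<pi> \<in> avoiding_from x (Suc n) \<longleftrightarrow> x \<le> Suc n \<and> \<pi> \<in> prepend x ` avoiding_perms n" for \<pi>
  proof
    assume "\<pi> \<in> avoiding_from x (Suc n)"
    hence "\<pi> \<in> avoiding_perms (Suc n)" "hd \<pi> = x" by (auto simp: avoiding_from_def)
    thus "x \<le> Suc n \<and> \<pi> \<in> prepend x ` avoiding_perms n"
      by (elim avoiding_cases) (auto simp: prepend_def)
  next
    assume "x \<le> Suc n \<and> \<pi> \<in> prepend x ` avoiding_perms n"
    thus "\<pi> \<in> avoiding_from x (Suc n)"
      using prepend_avoiding[OF _ assms] by (auto simp: avoiding_from_def prepend_def)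
  qed
  thus ?thesis by auto
qed

lemma avoiding_perms_Suc:
  "avoiding_perms (Suc n) = avoiding_from 1 (Suc n) \<union> avoiding_from 2 (Suc n)"
proof -
  have "\<pi> \<in> avoiding_from 1 (Suc n) \<union> avoiding_from 2 (Suc n)" if "\<pi> \<in> avoiding_perms (Suc n)" for \<pi>
    using that by (rule avoiding_cases) (use that in \<open>auto simp: avoiding_from_def prepend_def\<close>)
  thus ?thesis by (auto simp: avoiding_from_def)
qed

section \<open>Statistics\<close>

text \<open>
  Descents and the initial run are local, so they obey a recursion on the first two letters.  It
  shows at once that both depend only on the relative order of the letters, and what prepending
  a letter does to them.
\<close>
lemma DES_Nil: "DES [] = {}" and DES_single: "DES [x] = {}"
  by (auto simp: DES_def)

lemma DES_Cons_Cons: "DES (x # y # ys) = (if x > y then {1} else {}) \<union> Suc ` DES (y # ys)"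
proof (rule set_eqI)
  fix i
  show "i \<in> DES (x # y # ys) \<longleftrightarrow> i \<in> (if x > y then {1} else {}) \<union> Suc ` DES (y # ys)"
  proof (cases i)
    case (Suc k)
    thus ?thesis by (cases k) (auto simp: DES_def letter_def)
  qed (auto simp: DES_def)
qed

lemma finite_DES: "finite (DES xs)" and DES_pos: "0 \<notin> DES xs"
  by (auto simp: DES_def)

lemma des_Nil: "des [] = 0" and des_single: "des [x] = 0"
  by (simp_all add: des_def DES_Nil DES_single)

lemma des_Cons_Cons: "des (x # y # ys) = of_bool (x > y) + des (y # ys)"
proof -
  have "1 \<notin> Suc ` DES (y # ys)" using DES_pos by auto
  thus ?thesis
    by (simp add: des_def DES_Cons_Cons card_image finite_DES)
qed

lemma iar_Nil: "iar [] = 0" and iar_single: "iar [x] = 1"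
  by (simp_all add: iar_def DES_Nil DES_single)

lemma iar_Cons_Cons: "iar (x # y # ys) = (if x > y then 1 else Suc (iar (y # ys)))"
proof (cases "x > y")
  case True
  have "Min (DES (x # y # ys) \<union> {length (x # y # ys)}) = 1"
    using True by (intro Min_eqI) (auto simp: finite_DES DES_Cons_Cons)
  thus ?thesis using True by (simp add: iar_def)
next
  case False
  hence "DES (x # y # ys) \<union> {length (x # y # ys)} = Suc ` (DES (y # ys) \<union> {length (y # ys)})"
    by (simp add: DES_Cons_Cons)
  moreover have "Min (Suc ` (DES (y # ys) \<union> {length (y # ys)})) =
      Suc (Min (DES (y # ys) \<union> {length (y # ys)}))"
    by (rule mono_Min_commute[symmetric]) (simp_all add: finite_DES mono_Suc)
  ultimately show ?thesis using False
    unfolding iar_def by (simp only: if_False)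
qed

lemma des_map:
  assumes "strict_mono f"
  shows "des (map f xs) = des xs"
  by (induction xs rule: induct_list012)
     (simp_all add: des_Nil des_single des_Cons_Cons strict_mono_less[OF assms])

lemma iar_map:
  assumes "strict_mono f"
  shows "iar (map f xs) = iar xs"
  by (induction xs rule: induct_list012)
     (simp_all add: iar_Nil iar_single iar_Cons_Cons strict_mono_less[OF assms])

lemma des_prepend:
  "des (prepend x \<sigma>) = of_bool (\<sigma> \<noteq> [] \<and> hd \<sigma> < x) + des \<sigma>"
  using des_map[OF strict_mono_shift, of x \<sigma>]
  by (cases \<sigma>) (auto simp: prepend_def des_single des_Nil des_Cons_Cons shift_def)

lemma iar_prepend:
  "iar (prepend x \<sigma>) = (if \<sigma> \<noteq> [] \<and> hd \<sigma> < x then 1 else Suc (iar \<sigma>))"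
  using iar_map[OF strict_mono_shift, of x \<sigma>]
  by (cases \<sigma>) (auto simp: prepend_def iar_single iar_Nil iar_Cons_Cons shift_def)

text \<open>
  A component ends at \<open>i\<close> when the first \<open>i\<close> letters are at most \<open>i\<close>.  Both the position and, apart
  from the letter 1 below a leading 2, the letters move up by one, so the component ends of \<open>\<sigma>\<close> move
  up by one.  Position 1 is a new component end exactly when the leading letter is 1.
\<close>
lemma comp_positions_prepend:
  assumes "x \<in> {1, 2}" "0 \<notin> set \<sigma>"
  shows "{i \<in> {1..length (prepend x \<sigma>)}. \<forall>j\<in>{1..i}. letter (prepend x \<sigma>) j \<le> i} =
     (if x = 1 then {1} else {}) \<union> Suc ` {i \<in> {1..length \<sigma>}. \<forall>j\<in>{1..i}. letter \<sigma> j \<le> i}"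
  (is "?L = ?R")
proof (rule set_eqI)
  fix i
  have ball: "(\<forall>j\<in>{1..Suc k}. Q j) \<longleftrightarrow> Q 1 \<and> (\<forall>j\<in>{1..k}. Q (Suc j))" for Q k
  proof -
    have *: "{1..Suc k} = insert 1 (Suc ` {1..k})" by (auto simp: image_Suc_atLeastAtMost)
    show ?thesis unfolding * by blast
  qed
  (* Having k at least 1 is what makes the unmoved letter 1 harmless: it is at most k anyway. *)
  consider "i = 0" | "i = 1" | k where "i = Suc k" "k \<ge> 1" by (cases i; cases "i - 1") auto
  thus "i \<in> ?L \<longleftrightarrow> i \<in> ?R"
  proof cases
    case 3
    have "letter (prepend x \<sigma>) (Suc j) \<le> Suc k \<longleftrightarrow> letter \<sigma> j \<le> k"
      if "j \<in> {1..k}" "k \<le> length \<sigma>" for j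
    proof -
      have "letter (prepend x \<sigma>) (Suc j) = shift x (letter \<sigma> j)"
        using that by (auto simp: letter_def prepend_def nth_Cons')
      moreover have "letter \<sigma> j \<in> set \<sigma>" using that by (auto simp: letter_def)
      ultimately show ?thesis
        using assms(1) 3(2) assms(2) by (auto simp: shift_def)
    qed
    moreover have "letter (prepend x \<sigma>) 1 \<le> Suc k"
      using assms 3 by (auto simp: letter_def prepend_def)
    ultimately have "i \<in> ?L \<longleftrightarrow> k \<in> {i \<in> {1..length \<sigma>}. \<forall>j\<in>{1..i}. letter \<sigma> j \<le> i}"
      unfolding 3(1) mem_Collect_eq ball using 3 by (auto simp: prepend_def)
    thus ?thesis using 3 by auto
  qed (use assms in \<open>auto simp: letter_def prepend_def\<close>)
qed

lemma comp_prepend: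
  assumes "x \<in> {1, 2}" "0 \<notin> set \<sigma>"
  shows "comp (prepend x \<sigma>) = of_bool (x = 1) + comp \<sigma>"
  unfolding comp_def comp_positions_prepend[OF assms]
  by (subst card_Un_disjoint) (auto simp: card_image)

section \<open>Generating functions\<close>

definition wt :: "'a :: comm_ring_1 \<Rightarrow> 'a \<Rightarrow> 'a \<Rightarrow> nat list \<Rightarrow> 'a" where
  "wt t r p \<pi> = t ^ des \<pi> * r ^ iar \<pi> * p ^ comp \<pi>"

text \<open>The series written \<open>C r\<close> in the introduction.\<close>
definition gf_from_2 :: "'a :: comm_ring_1 \<Rightarrow> 'a \<Rightarrow> 'a \<Rightarrow> 'a fps" where
  "gf_from_2 t r p = Abs_fps (\<lambda>n. \<Sum>\<pi>\<in>avoiding_from 2 n. wt t r p \<pi>)"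

lemma avoidingD:
  assumes "\<sigma> \<in> avoiding_perms n"
  shows "0 \<notin> set \<sigma>" "\<sigma> = [] \<longleftrightarrow> n = 0" "\<sigma> \<noteq> [] \<Longrightarrow> hd \<sigma> \<ge> 1"
  using assms by (auto simp: avoiding_perms_iff Suc_le_eq dest: hd_in_set)

lemma wt_prepend_1:
  assumes "\<sigma> \<in> avoiding_perms n"
  shows "wt t r p (prepend 1 \<sigma>) = r * p * wt t r p \<sigma>"
  using avoidingD[OF assms] by (auto simp: wt_def des_prepend iar_prepend comp_prepend)

text \<open>
  The new descent at position 1 cuts the initial run down to length 1.  The run length of \<open>\<sigma>\<close> is
  lost, which is why the variable \<open>r\<close> is set to 1 on the right.
\<close>
lemma wt_prepend_2_from_1:
  assumes "\<sigma> \<in> avoiding_from 1 n"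
  shows "wt t r p (prepend 2 \<sigma>) = t * r * wt t 1 p \<sigma>"
  using assms avoidingD[of \<sigma> n]
  by (auto simp: avoiding_from_def wt_def des_prepend iar_prepend comp_prepend)

lemma wt_prepend_2_from_2:
  assumes "\<sigma> \<in> avoiding_from 2 n"
  shows "wt t r p (prepend 2 \<sigma>) = r * wt t r p \<sigma>"
  using assms avoidingD[of \<sigma> n]
  by (auto simp: avoiding_from_def wt_def des_prepend iar_prepend comp_prepend)

lemma sum_avoiding_from_1:
  "(\<Sum>\<pi>\<in>avoiding_from 1 (Suc n). wt t r p \<pi>) = r * p * (\<Sum>\<pi>\<in>avoiding_perms n. wt t r p \<pi>)"
  by (simp add: avoiding_from_Suc sum.reindex inj_on_subset[OF inj_prepend] wt_prepend_1
        sum_distrib_left del: One_nat_def)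

lemma sum_avoiding_Suc:
  "(\<Sum>\<pi>\<in>avoiding_perms (Suc n). g \<pi>) =
     (\<Sum>\<pi>\<in>avoiding_from 1 (Suc n). g \<pi>) + (\<Sum>\<pi>\<in>avoiding_from 2 (Suc n). g \<pi>)"
  unfolding avoiding_perms_Suc
  by (intro sum.union_disjoint) (auto simp: avoiding_from_def finite_avoiding)

text \<open>
  The lengths start at 2 because the word behind a leading 2 has to be nonempty; it is then split
  by its own first letter.
\<close>
lemma sum_avoiding_from_2:
  "(\<Sum>\<pi>\<in>avoiding_from 2 (Suc (Suc n)). wt t r p \<pi>) =
     t * r * (\<Sum>\<pi>\<in>avoiding_from 1 (Suc n). wt t 1 p \<pi>) +
     r * (\<Sum>\<pi>\<in>avoiding_from 2 (Suc n). wt t r p \<pi>)"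
proof -
  have "(\<Sum>\<pi>\<in>avoiding_from 2 (Suc (Suc n)). wt t r p \<pi>) =
        (\<Sum>\<sigma>\<in>avoiding_perms (Suc n). wt t r p (prepend 2 \<sigma>))"
    by (simp add: avoiding_from_Suc sum.reindex inj_on_subset[OF inj_prepend])
  also have "\<dots> = (\<Sum>\<sigma>\<in>avoiding_from 1 (Suc n). wt t r p (prepend 2 \<sigma>)) +
                  (\<Sum>\<sigma>\<in>avoiding_from 2 (Suc n). wt t r p (prepend 2 \<sigma>))"
    by (rule sum_avoiding_Suc)
  also have "(\<Sum>\<sigma>\<in>avoiding_from 1 (Suc n). wt t r p (prepend 2 \<sigma>)) =
      t * r * (\<Sum>\<pi>\<in>avoiding_from 1 (Suc n). wt t 1 p \<pi>)"
    unfolding sum_distrib_left by (intro sum.cong refl wt_prepend_2_from_1)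
  also have "(\<Sum>\<sigma>\<in>avoiding_from 2 (Suc n). wt t r p (prepend 2 \<sigma>)) =
      r * (\<Sum>\<pi>\<in>avoiding_from 2 (Suc n). wt t r p \<pi>)"
    unfolding sum_distrib_left by (intro sum.cong refl wt_prepend_2_from_2)
  finally show ?thesis .
qed

lemma gf_nth: "fps_nth (gf {[3,1,2], [3,2,1]} t r p) n = (\<Sum>\<pi>\<in>avoiding_perms n. wt t r p \<pi>)"
  by (simp add: gf_def wt_def avoiding_perms_def)

lemma gf_eq:
  "gf {[3,1,2], [3,2,1]} t r p =
     1 + fps_const (r * p) * fps_X * gf {[3,1,2], [3,2,1]} t r p + gf_from_2 t r p"
proof (rule fps_ext)
  fix n
  show "fps_nth (gf {[3,1,2], [3,2,1]} t r p) n = fps_nth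
     (1 + fps_const (r * p) * fps_X * gf {[3,1,2], [3,2,1]} t r p + gf_from_2 t r p) n"
  proof (cases n)
    case 0
    thus ?thesis
      by (simp add: gf_nth gf_from_2_def mult.assoc avoiding_perms_0 avoiding_from_0 wt_def
            des_Nil iar_Nil comp_def del: One_nat_def)
  next
    case (Suc m)
    thus ?thesis
      unfolding Suc gf_nth sum_avoiding_Suc sum_avoiding_from_1
      by (simp add: gf_nth gf_from_2_def mult.assoc del: One_nat_def)
  qed
qed

text \<open>
  The inner summand \<open>t r p z F 1\<close> comes from the avoiders \<open>prepend 2 (prepend 1 \<tau>)\<close>; the series of
  the words \<open>prepend 1 \<tau>\<close> at \<open>r = 1\<close> is \<open>p z F 1\<close>.
\<close>
lemma gf_from_2_eq:
  "gf_from_2 t r p =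
     fps_X * (fps_const (t * r * p) * fps_X * gf {[3,1,2], [3,2,1]} t 1 p
              + fps_const r * gf_from_2 t r p)"
proof (rule fps_ext)
  fix n
  consider "n = 0" | "n = 1" | m where "n = Suc (Suc m)" by (cases n; cases "n - 1") auto
  thus "fps_nth (gf_from_2 t r p) n = fps_nth
     (fps_X * (fps_const (t * r * p) * fps_X * gf {[3,1,2], [3,2,1]} t 1 p
              + fps_const r * gf_from_2 t r p)) n"
  proof cases
    case 1
    thus ?thesis by (simp add: gf_from_2_def avoiding_from_0)
  next
    case 2
    thus ?thesis by (simp add: gf_from_2_def avoiding_from_0 avoiding_from_Suc mult.assoc)
  next
    case 3
    thus ?thesis
      using sum_avoiding_from_2[of t r p m] sum_avoiding_from_1[of t 1 p m]
      by (simp add: gf_from_2_def gf_nth mult.assoc del: One_nat_def)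
  qed
qed

text \<open>
  Linear elimination: the system at \<open>r = 1\<close> gives \<open>F 1\<close>, and the system at \<open>r\<close> then gives \<open>F r\<close>.
  The result is kept free of denominators, so that it holds over any commutative ring.
\<close>
lemma gf_closed_form:
  fixes t r p :: "'a :: comm_ring_1"
  defines "T \<equiv> fps_const t" and "R \<equiv> fps_const r" and "Q \<equiv> fps_const p" and "Z \<equiv> fps_X"
  defines "D \<equiv> 1 - (1 + Q) * Z + (1 - T) * Q * Z ^ 2"
  shows "(1 - R * Q * Z) * (1 - R * Z) * D * gf {[3,1,2], [3,2,1]} t r p =
           (1 - R * Z) * D + R * Q * Z * ((1 - Z) * T * Z)"
proof -
  define F where "F = gf {[3,1,2], [3,2,1]} t r p"
  define F1 where "F1 = gf {[3,1,2], [3,2,1]} t 1 p"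
  define C where "C = gf_from_2 t r p"
  define C1 where "C1 = gf_from_2 t 1 p"
  have 1: "F = 1 + R * Q * Z * F + C"
    using gf_eq[of t r p] by (simp add: F_def C_def R_def Q_def Z_def)
  have 2: "C = Z * (T * R * Q * Z * F1 + R * C)"
    using gf_from_2_eq[of t r p] by (simp add: F1_def C_def T_def R_def Q_def Z_def)
  have 3: "F1 = 1 + Q * Z * F1 + C1"
    using gf_eq[of t 1 p] by (simp add: F1_def C1_def Q_def Z_def)
  have 4: "C1 = Z * (T * Q * Z * F1 + C1)"
    using gf_from_2_eq[of t 1 p] by (simp add: F1_def C1_def T_def Q_def Z_def)
  (* Eliminate C1: take the first equation at r = 1 times 1 - Z, plus the second. *)
  have "D * F1 - (1 - Z) =
      (1 - Z) * (F1 - (1 + Q * Z * F1 + C1)) + (C1 - Z * (T * Q * Z * F1 + C1))"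
    by (simp add: D_def algebra_simps power2_eq_square)
  also have "\<dots> = 0" using 3 4 by simp
  finally have DF1: "D * F1 = 1 - Z" by simp
  (* Eliminate C in the same way, with multiplier 1 - R * Z. *)
  have "(1 - R * Q * Z) * (1 - R * Z) * F - ((1 - R * Z) + T * R * Q * Z ^ 2 * F1) =
      (1 - R * Z) * (F - (1 + R * Q * Z * F + C)) + (C - Z * (T * R * Q * Z * F1 + R * C))"
    by (simp add: algebra_simps power2_eq_square)
  also have "\<dots> = 0" using 1 2 by simp
  finally have F: "(1 - R * Q * Z) * (1 - R * Z) * F = (1 - R * Z) + T * R * Q * Z ^ 2 * F1"
    by simp
  have "(1 - R * Q * Z) * (1 - R * Z) * D * F = D * ((1 - R * Q * Z) * (1 - R * Z) * F)"
    by (simp only: mult_ac)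
  also have "\<dots> = (1 - R * Z) * D + T * R * Q * Z ^ 2 * (D * F1)"
    unfolding F by (simp only: distrib_left mult_ac)
  also have "\<dots> = (1 - R * Z) * D + R * Q * Z * ((1 - Z) * T * Z)"
    unfolding DF1 by (simp only: power2_eq_square mult_ac)
  finally show ?thesis unfolding F_def .
qed

text \<open>
  The factors of the denominator are power series with constant term 1, hence nonzero; only \<open>r\<close>
  and \<open>p\<close>, by which \<open>gf_tilde\<close> divides, have to be assumed nonzero.
\<close>
theorem gf_tilde_closed_form:
  fixes t r p :: "'a :: idom"
  assumes "r \<noteq> 0" "p \<noteq> 0"
  shows "gf_tilde {[3,1,2], [3,2,1]} t r p =
    (let t = const t; r = const r; p = const p; z = var_z in
       1 / (1 - r * p * z) +
       ((1 - z) * t * z) /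
         ((1 - r * p * z) * (1 - r * z) * (1 - (1 + p) * z + (1 - t) * p * z ^ 2)))"
proof -
  define T R Q where "T = const t" and "R = const r" and "Q = const p"
  define Z :: "'a fps fract" where "Z = var_z"
  define F where "F = to_fract (gf {[3,1,2], [3,2,1]} t r p)"
  define D where "D = 1 - (1 + Q) * Z + (1 - T) * Q * Z ^ 2"
  note defs = T_def R_def Q_def Z_def const_def var_z_def
  have unit: "to_fract f \<noteq> 0" if "fps_nth f 0 = 1" for f :: "'a fps"
    using that by auto
  have a: "1 - R * Q * Z \<noteq> 0"
    using unit[of "1 - fps_const r * fps_const p * fps_X"] by (simp add: defs del: fps_const_mult)
  have b: "1 - R * Z \<noteq> 0"
    using unit[of "1 - fps_const r * fps_X"] by (simp add: defs del: fps_const_mult)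
  have c: "D \<noteq> 0"
    using unit[of "1 - (1 + fps_const p) * fps_X + (1 - fps_const t) * fps_const p * fps_X ^ 2"]
    by (simp add: D_def defs power2_eq_square del: fps_const_mult)
  have n: "R \<noteq> 0" "Q \<noteq> 0" "Z \<noteq> 0"
    using assms by (simp_all add: defs)
  have main: "(1 - R * Q * Z) * (1 - R * Z) * D * F =
      (1 - R * Z) * D + R * Q * Z * ((1 - Z) * T * Z)"
    using arg_cong[OF gf_closed_form[of r p t], of to_fract]
    by (simp add: F_def D_def defs power2_eq_square del: fps_const_mult)
  have "(F - 1) / (R * Q * Z) =
      1 / (1 - R * Q * Z) + ((1 - Z) * T * Z) / ((1 - R * Q * Z) * (1 - R * Z) * D)"
    using a b c n main by (simp add: divide_simps) algebra
  thus ?thesis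
    by (simp add: gf_tilde_def Let_def F_def D_def T_def R_def Q_def Z_def)
qed

theorem theorem4p10:
  shows "gf_tilde {[3,1,2], [3,2,1]} ind_t ind_r ind_p =
    (let t = const ind_t; r = const ind_r; p = const ind_p; z = var_z in
       1 / (1 - r * p * z) +
       ((1 - z) * t * z) /
         ((1 - r * p * z) * (1 - r * z) * (1 - (1 + p) * z + (1 - t) * p * z ^ 2)))"
  by (rule gf_tilde_closed_form) (simp_all add: ind_r_def ind_p_def)

end
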